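(* Let $\sigma_1,\sigma_2,r,T>0$, $D_1,D_2\in\mathbb{R}$, $-1\le\rho_1\le\rho_2\le1$, let $0<L_W<L_E$, $0<L_S<L_N$, $\Omega'=(\ln L_W,\ln L_E)\times(\ln L_S,\ln L_N)$, $Q_T=\Omega'\times(0,T)$, and let $\partial\Omega'=\partial\Omega_1'\cup\partial\Omega_2'$ with $\partial\Omega_2'\neq\emptyset$. Suppose that $u\in C(\overline{Q}_T)\cap C^{2,1}(Q_T)\cap C^{3,1}(Q_T\setminus\mathcal{S})$, where $\mathcal{S}=\{(x_1,x_2,\tau)\in Q_T:\ \frac{\partial^2u}{\partial x_1\partial x_2}(x_1,x_2,\tau)=0\}$, satisfies $$\frac{\partial u}{\partial\tau}-\frac12\sigma_1^2\frac{\partial^2u}{\partial x_1^2}-\frac12\sigma_2^2\frac{\partial^2u}{\partial x_2^2}-\rho\Big(\frac{\partial^2u}{\partial x_1\partial x_2}\Big)\sigma_1\sigma_2\frac{\partial^2u}{\partial x_1\partial x_2}-\Big(r-D_1-\frac12\sigma_1^2\Big)\frac{\partial u}{\partial x_1}-\Big(r-D_2-\frac12\sigma_2^2\Big)\frac{\partial u}{\partial x_2}+ru=0\quad\text{in }Q_T,$$ where $\rho(\gamma)=\rho_1$ if $\gamma>0$ and $\rho(\gamma)=\rho_2$ if $\gamma<0$, together with $$u(x_1,x_2,0)=g_0'(x_1,x_2)\ \text{in }\Omega',\qquad \frac{\partial u}{\partial n'}=g_1'(x_1,x_2,\tau)\ \text{on }\partial\Omega_1',\qquad u=g_2'(x_1,x_2,\tau)\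 \text{on }\partial\Omega_2',$$ and suppose $g_0'\ge0$ in $\Omega'$ and $g_i'\ge0$ on $\partial\Omega_i'$ for $i=1,2$. Then $u$ cannot attain a negative local minimum in $\overline{Q}_T\setminus\partial Q_T^p$, and $u\ge0$ on $\overline{Q}_T$.
   Context: $C^{m,q}(Q)$ denotes the space of functions on $Q$ having continuous derivatives in $x=(x_1,x_2)$ up to order $m$ and a continuous derivative in $\tau$ up to order $q$. $\partial/\partial n'$ is the derivative in the outward normal direction ($\pm\partial/\partial x_1$ on the sides $x_1=$ const, $\pm\partial/\partial x_2$ on the sides $x_2=$ const). $\partial Q_T^p$ is the parabolic boundary of $Q_T$: the boundary of $Q_T$ minus the interior of its top part $\Omega'\times\{\tau=T\}$. The value of $\rho(\gamma)$ at $\gamma=0$ is irrelevant, since it multiplies $\gamma$. *)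

theory Defs
  imports "HOL-Analysis.Analysis"
begin

text \<open>Points \<open>(x\<^sub>1, x\<^sub>2, \<tau>)\<close> are encoded as \<open>((x1, x2), t)\<close>, so that a space-time cylinder is literally
  a product \<open>\<Omega> \<times> I\<close>.\<close>

type_synonym point = "(real \<times> real) \<times> real"

fun dx1 :: "(point \<Rightarrow> real) \<Rightarrow> point \<Rightarrow> real" where
  "dx1 u ((x1, x2), t) = deriv (\<lambda>s. u ((s, x2), t)) x1"

fun dx2 :: "(point \<Rightarrow> real) \<Rightarrow> point \<Rightarrow> real" where
  "dx2 u ((x1, x2), t) = deriv (\<lambda>s. u ((x1, s), t)) x2"

fun dt :: "(point \<Rightarrow> real) \<Rightarrow> point \<Rightarrow> real" where
  "dt u ((x1, x2), t) = deriv (\<lambda>s. u ((x1, x2), s)) t"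

text \<open>\<open>C_space m Q u\<close>: all iterated partial derivatives of \<open>u\<close> in the space variables, in any order
  and of total order at most \<open>m\<close>, exist and are continuous on \<open>Q\<close>. The derivatives are two-sided, so
  this and the next two notions are meant for open \<open>Q\<close>; they then depend only on the values of \<open>u\<close>
  on \<open>Q\<close>.\<close>

fun C_space :: "nat \<Rightarrow> point set \<Rightarrow> (point \<Rightarrow> real) \<Rightarrow> bool" where
  "C_space 0 Q u \<longleftrightarrow> continuous_on Q u"
| "C_space (Suc m) Q u \<longleftrightarrow>
     continuous_on Q u \<and>
     (\<forall>x1 x2 t. ((x1, x2), t) \<in> Q \<longrightarrow>
        (\<lambda>s. u ((s, x2), t)) differentiable (at x1) \<and>
        (\<lambda>s. u ((x1, s), t)) differentiable (at x2)) \<and>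
     C_space m Q (dx1 u) \<and> C_space m Q (dx2 u)"

fun C_time :: "nat \<Rightarrow> point set \<Rightarrow> (point \<Rightarrow> real) \<Rightarrow> bool" where
  "C_time 0 Q u \<longleftrightarrow> continuous_on Q u"
| "C_time (Suc q) Q u \<longleftrightarrow>
     continuous_on Q u \<and>
     (\<forall>x1 x2 t. ((x1, x2), t) \<in> Q \<longrightarrow> (\<lambda>s. u ((x1, x2), s)) differentiable (at t)) \<and>
     C_time q Q (dt u)"

definition C_space_time :: "nat \<Rightarrow> nat \<Rightarrow> point set \<Rightarrow> (point \<Rightarrow> real) \<Rightarrow> bool" where
  "C_space_time m q Q u \<longleftrightarrow> C_space m Q u \<and> C_time q Q u"

text \<open>The top \<open>\<Omega> \<times> {T}\<close> lies in the hyperplane \<open>t = T\<close>, and its interior is taken there.\<close>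

definition parabolic_boundary :: "(real \<times> real) set \<Rightarrow> real \<Rightarrow> point set" where
  "parabolic_boundary \<Omega> T = frontier (\<Omega> \<times> {0<..<T}) - interior \<Omega> \<times> {T}"

text \<open>\<open>has_outer_normal_deriv a b c d u D ((x1, x2), t)\<close>: at the point \<open>(x1, x2)\<close> of the boundary of the
  rectangle \<open>(a, b) \<times> (c, d)\<close> and at time \<open>t\<close>, the number \<open>D\<close> is the derivative of \<open>u\<close> in the outward
  normal direction of a side containing the point. The derivatives are one-sided, taken from within
  the closed rectangle. At a non-corner point the side is unique; at a corner there is no unique
  normal, and \<open>D\<close> may be the normal derivative for either of the two adjacent sides.\<close>

fun has_outer_normal_deriv ::
  "real \<Rightarrow> real \<Rightarrow> real \<Rightarrow> real \<Rightarrow> (point \<Rightarrow> real) \<Rightarrow> real \<Rightarrow> point \<Rightarrow> bool" where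
  "has_outer_normal_deriv a b c d u D ((x1, x2), t) \<longleftrightarrow>
     x1 = a \<and> ((\<lambda>s. u ((s, x2), t)) has_real_derivative - D) (at a within {a..b}) \<or>
     x1 = b \<and> ((\<lambda>s. u ((s, x2), t)) has_real_derivative D) (at b within {a..b}) \<or>
     x2 = c \<and> ((\<lambda>s. u ((x1, s), t)) has_real_derivative - D) (at c within {c..d}) \<or>
     x2 = d \<and> ((\<lambda>s. u ((x1, s), t)) has_real_derivative D) (at d within {c..d})"

definition local_min_on :: "'a::metric_space set \<Rightarrow> ('a \<Rightarrow> real) \<Rightarrow> 'a \<Rightarrow> bool" where
  "local_min_on A f p \<longleftrightarrow> p \<in> A \<and> (\<exists>\<epsilon>>0. \<forall>q\<in>A. dist q p < \<epsilon> \<longrightarrow> f p \<le> f q)"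

end

theory Submission
  imports Defs
begin

text \<open>Since \<open>\<bar>\<rho>\<bar> \<le> 1\<close>, the second-order part of the equation is nonnegative at a spatial minimum, but it
  may be degenerate, so Hopf's boundary lemma is not available on the Neumann part. Instead \<open>u\<close> is
  perturbed to \<open>w = u + \<epsilon> \<psi>\<close>, where \<open>\<psi>\<close> is the squared distance to the centre of the rectangle: its outward
  normal derivative is positive on every side, so \<open>w\<close> has no minimum on the Neumann part, and its mixed
  derivative vanishes, so the nonlinear term does not change. At an interior minimum of \<open>w\<close> the
  equation yields \<open>r u \<ge> - C \<epsilon>\<close> with \<open>C\<close> independent of \<open>\<epsilon>\<close>, and \<open>\<epsilon> \<rightarrow> 0\<close> gives \<open>u \<ge> 0\<close>. This excludes
  negative local minima altogether.\<close>

section \<open>Second-order conditions at an interior spatial minimum\<close>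

lemma taylor_second_order:
  fixes f f' f'' :: "real \<Rightarrow> real"
  assumes "h > 0"
    and "\<And>s. 0 \<le> s \<Longrightarrow> s \<le> h \<Longrightarrow> (f has_real_derivative f' s) (at s)"
    and "\<And>s. 0 \<le> s \<Longrightarrow> s \<le> h \<Longrightarrow> (f' has_real_derivative f'' s) (at s)"
  obtains \<xi> where "0 < \<xi>" "\<xi> < h" "f h = f 0 + f' 0 * h + f'' \<xi> / 2 * h\<^sup>2"
proof -
  define D where "D = (\<lambda>m::nat. if m = 0 then f else if m = 1 then f' else f'')"
  have "\<exists>t>0. t < h \<and> f h = (\<Sum>m<2. D m 0 / fact m * h ^ m) + D 2 t / fact 2 * h ^ 2"
    by (rule Maclaurin) (use assms in \<open>auto simp: D_def less_2_cases_iff\<close>)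
  then show thesis
    by (auto simp: D_def numeral_2_eq_2 intro!: that)
qed

text \<open>Expanding first in \<open>x\<close> and then in \<open>y\<close> involves only one of the two mixed derivatives, so their
  equality is not needed.\<close>

lemma hessian_nonneg_at_minimum:
  fixes f fx fy fxx fxy fyy :: "real \<times> real \<Rightarrow> real"
  assumes U: "open U" "(a, b) \<in> U"
    and fx: "\<And>x y. (x, y) \<in> U \<Longrightarrow> ((\<lambda>s. f (s, y)) has_real_derivative fx (x, y)) (at x)"
    and fy: "\<And>x y. (x, y) \<in> U \<Longrightarrow> ((\<lambda>s. f (x, s)) has_real_derivative fy (x, y)) (at y)"
    and fxx: "\<And>x y. (x, y) \<in> U \<Longrightarrow> ((\<lambda>s. fx (s, y)) has_real_derivative fxx (x, y)) (at x)"
    and fxy: "\<And>x y. (x, y) \<in> U \<Longrightarrow> ((\<lambda>s. fy (s, y)) has_real_derivative fxy (x, y)) (at x)"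
    and fyy: "\<And>x y. (x, y) \<in> U \<Longrightarrow> ((\<lambda>s. fy (x, s)) has_real_derivative fyy (x, y)) (at y)"
    and cont: "isCont fxx (a, b)" "isCont fxy (a, b)" "isCont fyy (a, b)"
    and min: "\<And>z. z \<in> U \<Longrightarrow> f (a, b) \<le> f z"
  shows "fx (a, b) = 0" "fy (a, b) = 0"
    and "0 \<le> p\<^sup>2 * fxx (a, b) + 2 * p * q * fxy (a, b) + q\<^sup>2 * fyy (a, b)"
proof -
  obtain e where e: "e > 0" and eU: "ball (a, b) e \<subseteq> U"
    using U open_contains_ball by blast
  \<comment> \<open>Neighbourhoods are measured by the sum of coordinate distances, because the
    displacements below have the form \<open>(s * p, t * q)\<close> and are estimated
    coordinatewise.\<close>
  have inU: "(x, y) \<in> U" if "\<bar>x - a\<bar> + \<bar>y - b\<bar> < e" for x y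
  proof -
    have "dist (a, b) (x, y) \<le> \<bar>x - a\<bar> + \<bar>y - b\<bar>"
      using norm_Pair_le[of "a - x" "b - y"] by (simp add: dist_norm abs_minus_commute)
    with that eU show ?thesis by (auto simp: subset_iff)
  qed
  show fx0: "fx (a, b) = 0"
    by (rule DERIV_local_min[OF fx[OF U(2)] e]) (auto intro!: min inU)
  show fy0: "fy (a, b) = 0"
    by (rule DERIV_local_min[OF fy[OF U(2)] e]) (auto intro!: min inU)
  show "0 \<le> p\<^sup>2 * fxx (a, b) + 2 * p * q * fxy (a, b) + q\<^sup>2 * fyy (a, b)"
  proof (rule ccontr)
    assume "\<not> ?thesis"
    moreover define M where "M = p\<^sup>2 * fxx (a, b) + 2 * p * q * fxy (a, b) + q\<^sup>2 * fyy (a, b)"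
    ultimately have M: "- M / 3 > 0" by simp
    \<comment> \<open>The value \<open>M\<close> of the form is now negative. Each of its three
      terms may exceed its value at \<open>(a, b)\<close> by less than \<open>- M / 3\<close>, so
      their sum, even with each term taken at a different nearby point, stays below
      \<open>M - M = 0\<close>. The coefficient \<open>k\<close> is kept inside the estimate so that
      its sign does not matter.\<close>
    have close: "\<exists>d>0. \<forall>x y. \<bar>x - a\<bar> + \<bar>y - b\<bar> < d \<longrightarrow> k * g (x, y) < k * g (a, b) - M / 3"
      if "isCont g (a, b)" for g :: "real \<times> real \<Rightarrow> real" and k
    proof -
      have "isCont (\<lambda>z. k * g z) (a, b)"
        using that by (intro continuous_intros)
      then obtain d where d: "d > 0"
        "\<And>z. dist z (a, b) < d \<Longrightarrow> dist (k * g z) (k * g (a, b)) < - M / 3"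
        using M unfolding continuous_at_eps_delta by blast
      have "k * g (x, y) < k * g (a, b) - M / 3" if "\<bar>x - a\<bar> + \<bar>y - b\<bar> < d" for x y
      proof -
        have "dist (x, y) (a, b) < d"
          using norm_Pair_le[of "x - a" "y - b"] that by (simp add: dist_norm)
        from d(2)[OF this] show ?thesis by (auto simp: dist_real_def)
      qed
      with d(1) show ?thesis by blast
    qed
    obtain d1 where d1: "d1 > 0"
      "\<And>x y. \<bar>x - a\<bar> + \<bar>y - b\<bar> < d1 \<Longrightarrow> p\<^sup>2 * fxx (x, y) < p\<^sup>2 * fxx (a, b) - M / 3"
      using close[OF cont(1)] by metis
    obtain d2 where d2: "d2 > 0"
      "\<And>x y. \<bar>x - a\<bar> + \<bar>y - b\<bar> < d2 \<Longrightarrow> (2 * p * q) * fxy (x, y) < (2 * p * q) * fxy (a, b) - M / 3"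
      using close[OF cont(2)] by metis
    obtain d3 where d3: "d3 > 0"
      "\<And>x y. \<bar>x - a\<bar> + \<bar>y - b\<bar> < d3 \<Longrightarrow> q\<^sup>2 * fyy (x, y) < q\<^sup>2 * fyy (a, b) - M / 3"
      using close[OF cont(3)] by metis
    define d where "d = min (min e d1) (min d2 d3)"
    have d: "d > 0" "d \<le> e" "d \<le> d1" "d \<le> d2" "d \<le> d3"
      using e d1(1) d2(1) d3(1) by (auto simp: d_def)
    \<comment> \<open>The summand 1 keeps the denominator positive when \<open>p = q = 0\<close>. It
      and the factor 2 make the estimate \<open>hd\<close> strict.\<close>
    define h where "h = d / (2 * (\<bar>p\<bar> + \<bar>q\<bar> + 1))"
    have h: "h > 0" using d by (simp add: h_def)
    have hd: "\<bar>s * p\<bar> + \<bar>t * q\<bar> < d" if "0 \<le> s" "s \<le> h" "0 \<le> t" "t \<le> h" for s t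
    proof -
      have "\<bar>s * p\<bar> + \<bar>t * q\<bar> \<le> h * \<bar>p\<bar> + h * \<bar>q\<bar>"
        using that by (auto simp: abs_mult intro!: add_mono mult_right_mono)
      also have "\<dots> < h * (2 * (\<bar>p\<bar> + \<bar>q\<bar> + 1))"
        using h mult_nonneg_nonneg[of h "\<bar>p\<bar>"] mult_nonneg_nonneg[of h "\<bar>q\<bar>"]
        by (simp add: algebra_simps del: mult_nonneg_nonneg)
      also have "\<dots> = d" by (simp add: h_def)
      finally show ?thesis .
    qed
    have sU: "(a + s * p, b + t * q) \<in> U" if "0 \<le> s" "s \<le> h" "0 \<le> t" "t \<le> h" for s t
      using hd[OF that] d by (intro inU) auto
    have line: "((\<lambda>s. k * g (c + s * m)) has_real_derivative (k * m * D)) (at s)"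
      if "(g has_real_derivative D) (at (c + s * m))" for g :: "real \<Rightarrow> real" and c m k D s
    proof -
      have "((\<lambda>s. c + s * m) has_real_derivative m) (at s)"
        by (auto intro!: derivative_eq_intros)
      from DERIV_chain2[OF that this] show ?thesis
        by (auto intro!: derivative_eq_intros)
    qed
    \<comment> \<open>The point \<open>(a + h * p, b + h * q)\<close> is reached by two legs
      parallel to the axes: first from \<open>(a, b)\<close> in x, then in y.\<close>
    obtain \<xi> where \<xi>: "0 < \<xi>" "\<xi> < h"
      "f (a + h * p, b) = f (a, b) + p * fx (a, b) * h + p * p * fxx (a + \<xi> * p, b) / 2 * h\<^sup>2"
    proof (rule taylor_second_order[OF h, of "\<lambda>s. f (a + s * p, b)" "\<lambda>s. p * fx (a + s * p, b)"
          "\<lambda>s. p * p * fxx (a + s * p, b)"])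
      fix s assume s: "0 \<le> s" "s \<le> h"
      have sU': "(a + s * p, b) \<in> U" using sU[OF s, of 0] h by simp
      show "((\<lambda>s. f (a + s * p, b)) has_real_derivative p * fx (a + s * p, b)) (at s)"
        using line[OF fx[OF sU'], of 1] by simp
      show "((\<lambda>s. p * fx (a + s * p, b)) has_real_derivative p * p * fxx (a + s * p, b)) (at s)"
        using line[OF fxx[OF sU'], of p] by simp
    qed (use that in auto)
    obtain \<eta> where \<eta>: "0 < \<eta>" "\<eta> < h"
      "f (a + h * p, b + h * q) = f (a + h * p, b) + q * fy (a + h * p, b) * h
         + q * q * fyy (a + h * p, b + \<eta> * q) / 2 * h\<^sup>2"
    proof (rule taylor_second_order[OF h, of "\<lambda>s. f (a + h * p, b + s * q)"
          "\<lambda>s. q * fy (a + h * p, b + s * q)" "\<lambda>s. q * q * fyy (a + h * p, b + s * q)"])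
      fix s assume s: "0 \<le> s" "s \<le> h"
      have sU': "(a + h * p, b + s * q) \<in> U" using sU[OF _ _ s, of h] h by simp
      show "((\<lambda>s. f (a + h * p, b + s * q)) has_real_derivative q * fy (a + h * p, b + s * q)) (at s)"
        using line[OF fy[OF sU'], of 1] by simp
      show "((\<lambda>s. q * fy (a + h * p, b + s * q)) has_real_derivative
          q * q * fyy (a + h * p, b + s * q)) (at s)"
        using line[OF fyy[OF sU'], of q] by simp
    qed (use that in auto)
    \<comment> \<open>The second leg starts away from \<open>(a, b)\<close>, so its linear term need
      not vanish. Since \<open>fy (a, b) = 0\<close>, the mean value theorem in x turns that term
      into the mixed one, of order \<open>h\<^sup>2\<close>. It comes without the Taylor factor 1/2,
      which is why the mixed term has coefficient 2 in the form.\<close>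
    have "\<exists>z. 0 < z \<and> z < h \<and>
        q * fy (a + h * p, b) - q * fy (a + 0 * p, b) = (h - 0) * (q * p * fxy (a + z * p, b))"
    proof (rule MVT2[OF h])
      fix s assume s: "0 \<le> s" "s \<le> h"
      have sU': "(a + s * p, b) \<in> U" using sU[OF s, of 0] h by simp
      show "((\<lambda>s. q * fy (a + s * p, b)) has_real_derivative q * p * fxy (a + s * p, b)) (at s)"
        by (rule line[OF fxy[OF sU']])
    qed
    then obtain \<zeta> where \<zeta>: "0 < \<zeta>" "\<zeta> < h" "q * fy (a + h * p, b) = h * (q * p * fxy (a + \<zeta> * p, b))"
      using fy0 by auto
    have 1: "p\<^sup>2 * fxx (a + \<xi> * p, b) < p\<^sup>2 * fxx (a, b) - M / 3"
      using hd[of \<xi> 0] \<xi> h d by (intro d1(2)) auto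
    have 2: "(2 * p * q) * fxy (a + \<zeta> * p, b) < (2 * p * q) * fxy (a, b) - M / 3"
      using hd[of \<zeta> 0] \<zeta> h d by (intro d2(2)) auto
    have 3: "q\<^sup>2 * fyy (a + h * p, b + \<eta> * q) < q\<^sup>2 * fyy (a, b) - M / 3"
      using hd[of h \<eta>] \<eta> h d by (intro d3(2)) auto
    have "f (a + h * p, b + h * q) = f (a, b) + h\<^sup>2 / 2 * (p\<^sup>2 * fxx (a + \<xi> * p, b)
        + (2 * p * q) * fxy (a + \<zeta> * p, b) + q\<^sup>2 * fyy (a + h * p, b + \<eta> * q))"
      unfolding \<eta>(3) \<xi>(3) \<zeta>(3) fx0 by (simp add: power2_eq_square algebra_simps)
    also have "\<dots> < f (a, b)"
    proof -
      have "p\<^sup>2 * fxx (a + \<xi> * p, b)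
        + (2 * p * q) * fxy (a + \<zeta> * p, b) + q\<^sup>2 * fyy (a + h * p, b + \<eta> * q) < 0"
        using 1 2 3 M_def by linarith
      then show ?thesis using h by (simp add: mult_less_0_iff)
    qed
    also have "\<dots> \<le> f (a + h * p, b + h * q)"
      using h by (intro min sU) auto
    finally show False by simp
  qed
qed

section \<open>Derivative signs at a boundary minimum\<close>

lemma left_derivative_nonpos_at_minimum:
  fixes f :: "real \<Rightarrow> real"
  assumes "(f has_real_derivative D) (at b within {a..b})" "a < b"
    and "\<And>s. a \<le> s \<Longrightarrow> s \<le> b \<Longrightarrow> f b \<le> f s"
  shows "D \<le> 0"
proof (rule ccontr)
  assume "\<not> ?thesis"
  then obtain d where d: "d > 0" "\<And>h. h > 0 \<Longrightarrow> b - h \<in> {a..b} \<Longrightarrow> h < d \<Longrightarrow> f (b - h) < f b"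
    using has_real_derivative_pos_inc_left[OF assms(1)] by (metis not_le)
  define h where "h = min (d / 2) (b - a)"
  have h: "0 < h" "h < d" "h \<le> b - a"
    using d(1) assms(2) by (auto simp: h_def)
  show False
    using d(2)[of h] assms(3)[of "b - h"] h by simp
qed

lemma right_derivative_nonneg_at_minimum:
  fixes f :: "real \<Rightarrow> real"
  assumes "(f has_real_derivative D) (at a within {a..b})" "a < b"
    and "\<And>s. a \<le> s \<Longrightarrow> s \<le> b \<Longrightarrow> f a \<le> f s"
  shows "D \<ge> 0"
proof (rule ccontr)
  assume "\<not> ?thesis"
  then obtain d where d: "d > 0" "\<And>h. h > 0 \<Longrightarrow> a + h \<in> {a..b} \<Longrightarrow> h < d \<Longrightarrow> f a > f (a + h)"
    using has_real_derivative_neg_dec_right[OF assms(1)] by (metis not_le)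
  define h where "h = min (d / 2) (b - a)"
  have h: "0 < h" "h < d" "h \<le> b - a"
    using d(1) assms(2) by (auto simp: h_def)
  show False
    using d(2)[of h] assms(3)[of "a + h"] h by simp
qed

text \<open>Moving inward from a minimum cannot decrease the function, whichever side
  \<open>D\<close> belongs to. Hence a corner is covered by the same argument for either adjacent
  side.\<close>

lemma outer_normal_deriv_nonpos_at_minimum:
  assumes "has_outer_normal_deriv a b c d w D ((x, y), t)" "a < b" "c < d"
    and "x \<in> {a..b}" "y \<in> {c..d}"
    and min: "\<And>x' y'. x' \<in> {a..b} \<Longrightarrow> y' \<in> {c..d} \<Longrightarrow> w ((x, y), t) \<le> w ((x', y'), t)"
  shows "D \<le> 0"
proof -
  from assms(1) consider
      "x = a" "((\<lambda>s. w ((s, y), t)) has_real_derivative - D) (at a within {a..b})"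
    | "x = b" "((\<lambda>s. w ((s, y), t)) has_real_derivative D) (at b within {a..b})"
    | "y = c" "((\<lambda>s. w ((x, s), t)) has_real_derivative - D) (at c within {c..d})"
    | "y = d" "((\<lambda>s. w ((x, s), t)) has_real_derivative D) (at d within {c..d})"
    by auto
  then show ?thesis
  proof cases
    case 1
    have "- D \<ge> 0"
      by (rule right_derivative_nonneg_at_minimum[OF 1(2) assms(2)]) (use 1 assms in auto)
    then show ?thesis by simp
  next
    case 2
    show ?thesis
      by (rule left_derivative_nonpos_at_minimum[OF 2(2) assms(2)]) (use 2 assms in auto)
  next
    case 3
    have "- D \<ge> 0"
      by (rule right_derivative_nonneg_at_minimum[OF 3(2) assms(3)]) (use 3 assms in auto)
    then show ?thesis by simp
  next
    case 4
    show ?thesis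
      by (rule left_derivative_nonpos_at_minimum[OF 4(2) assms(3)]) (use 4 assms in auto)
  qed
qed

section \<open>The perturbation\<close>

definition sq_dist_centre :: "real \<Rightarrow> real \<Rightarrow> real \<Rightarrow> real \<Rightarrow> real \<times> real \<Rightarrow> real" where
  "sq_dist_centre a b c d z = (fst z - (a + b) / 2)\<^sup>2 + (snd z - (c + d) / 2)\<^sup>2"

text \<open>The centre is equidistant from opposite sides, so the outward slope of the perturbation
  is the same constant on both sides of a pair: \<open>\<epsilon> * (b - a)\<close> or
  \<open>\<epsilon> * (d - c)\<close>. The disjunction says which pair \<open>D\<close> refers
  to.\<close>

lemma has_outer_normal_deriv_add_sq_dist_centre:
  assumes "has_outer_normal_deriv a b c d u D (z, t)"
  shows "has_outer_normal_deriv a b c d (\<lambda>p. u p + \<epsilon> * sq_dist_centre a b c d (fst p))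
           (D + \<epsilon> * (b - a)) (z, t) \<or>
         has_outer_normal_deriv a b c d (\<lambda>p. u p + \<epsilon> * sq_dist_centre a b c d (fst p))
           (D + \<epsilon> * (d - c)) (z, t)"
proof -
  obtain x y where z: "z = (x, y)" by force
  have 1: "((\<lambda>s. \<epsilon> * sq_dist_centre a b c d (s, y)) has_real_derivative \<epsilon> * (2 * x - (a + b)))
      (at x within A)" for x A
    unfolding sq_dist_centre_def by (auto intro!: derivative_eq_intros simp: algebra_simps)
  have 2: "((\<lambda>s. \<epsilon> * sq_dist_centre a b c d (x, s)) has_real_derivative \<epsilon> * (2 * y - (c + d)))
      (at y within A)" for y A
    unfolding sq_dist_centre_def by (auto intro!: derivative_eq_intros simp: algebra_simps)
  show ?thesis
    using assms DERIV_add[OF _ 1, of "\<lambda>s. u ((s, y), t)" "- D" a "{a..b}"]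
      DERIV_add[OF _ 1, of "\<lambda>s. u ((s, y), t)" D b "{a..b}"]
      DERIV_add[OF _ 2, of "\<lambda>s. u ((x, s), t)" "- D" c "{c..d}"]
      DERIV_add[OF _ 2, of "\<lambda>s. u ((x, s), t)" D d "{c..d}"]
    unfolding z has_outer_normal_deriv.simps
    by (auto simp: algebra_simps)
qed

section \<open>Derivatives supplied by the regularity class\<close>

lemma C_space_2_derivatives:
  assumes "C_space 2 Q u" "((x, y), t) \<in> Q"
  shows "((\<lambda>s. u ((s, y), t)) has_real_derivative dx1 u ((x, y), t)) (at x)"
    and "((\<lambda>s. u ((x, s), t)) has_real_derivative dx2 u ((x, y), t)) (at y)"
    and "((\<lambda>s. dx1 u ((s, y), t)) has_real_derivative dx1 (dx1 u) ((x, y), t)) (at x)"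
    and "((\<lambda>s. dx2 u ((s, y), t)) has_real_derivative dx1 (dx2 u) ((x, y), t)) (at x)"
    and "((\<lambda>s. dx2 u ((x, s), t)) has_real_derivative dx2 (dx2 u) ((x, y), t)) (at y)"
  using assms by (auto simp: numeral_2_eq_2 DERIV_deriv_iff_real_differentiable
      simp del: dx1.simps dx2.simps simp: dx1.simps[of u] dx2.simps[of u]
        dx1.simps[of "dx1 u"] dx1.simps[of "dx2 u"] dx2.simps[of "dx2 u"])

lemma C_space_2_continuous:
  assumes "C_space 2 Q u"
  shows "continuous_on Q (dx1 (dx1 u))" "continuous_on Q (dx1 (dx2 u))"
    "continuous_on Q (dx2 (dx2 u))"
  using assms by (auto simp: numeral_2_eq_2)

section \<open>The minimum principle\<close>

theorem theorem1:
  fixes \<sigma>1 \<sigma>2 r T D1 D2 \<rho>1 \<rho>2 L_W L_E L_S L_N :: real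
    and \<rho> :: "real \<Rightarrow> real"
    and \<Omega> B1 B2 :: "(real \<times> real) set"
    and Q S :: "point set"
    and u g1 g2 :: "point \<Rightarrow> real"
    and g0 :: "real \<times> real \<Rightarrow> real"
  assumes "\<sigma>1 > 0" "\<sigma>2 > 0" "r > 0" "T > 0"
    and "-1 \<le> \<rho>1" "\<rho>1 \<le> \<rho>2" "\<rho>2 \<le> 1"
    and "0 < L_W" "L_W < L_E" "0 < L_S" "L_S < L_N"
    and rho: "\<And>\<gamma>. \<gamma> > 0 \<Longrightarrow> \<rho> \<gamma> = \<rho>1" "\<And>\<gamma>. \<gamma> < 0 \<Longrightarrow> \<rho> \<gamma> = \<rho>2"
    and Omega: "\<Omega> = {ln L_W<..<ln L_E} \<times> {ln L_S<..<ln L_N}"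
    and Q: "Q = \<Omega> \<times> {0<..<T}"
    and boundary: "frontier \<Omega> = B1 \<union> B2" "B2 \<noteq> {}"
    and S: "S = {p \<in> Q. dx1 (dx2 u) p = 0}"
    and regularity: "continuous_on (closure Q) u" "C_space_time 2 1 Q u"
      "C_space_time 3 1 (Q - S) u"
    and pde: "\<And>p. p \<in> Q \<Longrightarrow>
      dt u p - 1/2 * \<sigma>1\<^sup>2 * dx1 (dx1 u) p - 1/2 * \<sigma>2\<^sup>2 * dx2 (dx2 u) p
        - \<rho> (dx1 (dx2 u) p) * \<sigma>1 * \<sigma>2 * dx1 (dx2 u) p
        - (r - D1 - 1/2 * \<sigma>1\<^sup>2) * dx1 u p - (r - D2 - 1/2 * \<sigma>2\<^sup>2) * dx2 u p
        + r * u p = 0"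
    and initial: "\<And>x. x \<in> \<Omega> \<Longrightarrow> u (x, 0) = g0 x"
    and neumann: "\<And>x t. x \<in> B1 \<Longrightarrow> t \<in> {0<..<T} \<Longrightarrow>
      has_outer_normal_deriv (ln L_W) (ln L_E) (ln L_S) (ln L_N) u (g1 (x, t)) (x, t)"
    and dirichlet: "\<And>x t. x \<in> B2 \<Longrightarrow> t \<in> {0<..<T} \<Longrightarrow> u (x, t) = g2 (x, t)"
    and nonneg: "\<And>x. x \<in> \<Omega> \<Longrightarrow> g0 x \<ge> 0"
      "\<And>x t. x \<in> B1 \<Longrightarrow> t \<in> {0<..<T} \<Longrightarrow> g1 (x, t) \<ge> 0"
      "\<And>x t. x \<in> B2 \<Longrightarrow> t \<in> {0<..<T} \<Longrightarrow> g2 (x, t) \<ge> 0"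
  shows "\<not> (\<exists>p \<in> closure Q - parabolic_boundary \<Omega> T. u p < 0 \<and> local_min_on (closure Q) u p)
    \<and> (\<forall>p \<in> closure Q. u p \<ge> 0)"
proof -
  define a b c d where abcd: "a = ln L_W" "b = ln L_E" "c = ln L_S" "d = ln L_N"
  have ab: "a < b" and cd: "c < d"
    using assms(8-11) by (auto simp: abcd)
  have Om: "\<Omega> = {a<..<b} \<times> {c<..<d}" by (simp add: Omega abcd)
  have openOm: "open \<Omega>" unfolding Om by (intro open_Times) auto
  have openQ: "open Q" unfolding Q by (intro open_Times openOm) auto
  have clOm: "closure \<Omega> = {a..b} \<times> {c..d}"
    using ab cd by (simp add: Om closure_Times)
  have clQ: "closure Q = closure \<Omega> \<times> {0..T}"
    using \<open>T > 0\<close> by (simp add: Q closure_Times)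
  have C2: "C_space 2 Q u" and C1: "C_time 1 Q u"
    using regularity(2) by (auto simp: C_space_time_def)
  note deriv = C_space_2_derivatives[OF C2] and cont = C_space_2_continuous[OF C2]
  let ?\<psi> = "sq_dist_centre a b c d"
  have psi_nonneg: "?\<psi> z \<ge> 0" for z by (simp add: sq_dist_centre_def)
  define k1 where "k1 = r - D1 - 1/2 * \<sigma>1\<^sup>2"
  define k2 where "k2 = r - D2 - 1/2 * \<sigma>2\<^sup>2"
  \<comment> \<open>\<open>\<epsilon> * C\<close> bounds what the perturbation adds to the equation:
    both pure second derivatives of \<open>?\<psi>\<close> are 2, and on the rectangle its first
    derivatives are at most \<open>b - a\<close> and \<open>d - c\<close> in absolute value.\<close>
  define C where "C = \<sigma>1\<^sup>2 + \<sigma>2\<^sup>2 + \<bar>k1\<bar> * (b - a) + \<bar>k2\<bar> * (d - c)"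
  have C: "C \<ge> 0" using ab cd by (auto simp: C_def)

  \<comment> \<open>The initial data are prescribed on the open rectangle only; continuity of
    \<open>u\<close> carries their sign to its edges.\<close>
  have initial_nonneg: "u (z, 0) \<ge> 0" if "z \<in> closure \<Omega>" for z
  proof (rule continuous_ge_on_closure[of \<Omega> "\<lambda>z. u (z, 0)"])
    show "continuous_on (closure \<Omega>) (\<lambda>z. u (z, 0))"
      using \<open>T > 0\<close> by (intro continuous_on_compose2[OF regularity(1)] continuous_intros) (auto simp: clQ)
  qed (use that initial nonneg(1) in auto)

  have bound: "u (z0, t0) \<ge> - (\<epsilon> * (C / r + ?\<psi> z0))"
    if z0: "z0 \<in> \<Omega>" and t0: "0 < t0" "t0 < T" and \<epsilon>: "\<epsilon> > 0" for z0 t0 \<epsilon>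
  proof -
    define w where "w = (\<lambda>p. u p + \<epsilon> * ?\<psi> (fst p))"
    \<comment> \<open>The cylinder is stopped at \<open>t0 < T\<close>. Thus a minimum at the last
      time of \<open>K\<close> still lies before \<open>T\<close>, where the equation and the
      lateral conditions hold.\<close>
    define K where "K = closure \<Omega> \<times> {0..t0}"
    have "compact K" unfolding K_def clOm by (intro compact_Times) auto
    moreover have z0K: "(z0, t0) \<in> K"
      using z0 t0 closure_subset by (auto simp: K_def)
    moreover have "continuous_on K w"
      unfolding w_def sq_dist_centre_def
      by (intro continuous_intros continuous_on_subset[OF regularity(1)]) (use t0 in \<open>auto simp: K_def clQ\<close>)
    ultimately obtain P where P: "P \<in> K" and minP: "\<And>q. q \<in> K \<Longrightarrow> w P \<le> w q"
      using continuous_attains_inf[of K w] by blast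
    obtain x y s where Peq: "P = ((x, y), s)" by (metis prod.exhaust)
    have xy: "(x, y) \<in> closure \<Omega>" and s: "0 \<le> s" "s \<le> t0"
      using P by (auto simp: K_def Peq)
    have min_xy: "w ((x, y), s) \<le> w (z, s)" if "z \<in> closure \<Omega>" for z
      using minP[of "(z, s)"] that s by (auto simp: K_def Peq)
    have uP: "u P \<ge> - (\<epsilon> * (C / r))"
    proof -
      have neg: "- (\<epsilon> * (C / r)) \<le> 0" using \<epsilon> C \<open>r > 0\<close> by simp
      consider "s = 0" | "s > 0" "(x, y) \<in> B2" | "s > 0" "(x, y) \<in> B1" | "s > 0" "(x, y) \<in> \<Omega>"
        using s xy boundary(1) openOm by (force simp: frontier_def interior_open)
      then show ?thesis
      proof cases
        case 1
        then show ?thesis using initial_nonneg[OF xy] neg by (simp add: Peq)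
      next
        case 2
        then have "u P \<ge> 0"
          unfolding Peq using dirichlet nonneg(3) s t0 by force
        then show ?thesis using neg by linarith
      next
        case 3
        then have sT: "s \<in> {0<..<T}" using s t0 by auto
        have "has_outer_normal_deriv a b c d u (g1 ((x, y), s)) ((x, y), s)"
          using neumann[OF 3(2) sT] by (simp only: abcd)
        \<comment> \<open>This case is contradictory: the minimum forces a nonpositive normal
          derivative of \<open>w\<close>, while \<open>g1 \<ge> 0\<close> and the perturbation make
          it positive.\<close>
        from has_outer_normal_deriv_add_sq_dist_centre[OF this, of \<epsilon>]
        have "g1 ((x, y), s) + \<epsilon> * (b - a) \<le> 0 \<or> g1 ((x, y), s) + \<epsilon> * (d - c) \<le> 0"
          unfolding w_def[symmetric] using xy min_xy
          by (auto simp: clOm simp del: has_outer_normal_deriv.simps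
              dest: outer_normal_deriv_nonpos_at_minimum[OF _ ab cd])
        moreover have "\<epsilon> * (b - a) > 0" "\<epsilon> * (d - c) > 0" using \<epsilon> ab cd by auto
        ultimately show ?thesis using nonneg(2)[OF 3(2) sT] by linarith
      next
        case 4
        have PQ: "P \<in> Q" using 4 s t0 by (auto simp: Q Peq)
        have inQ: "((x', y'), s) \<in> Q" if "(x', y') \<in> \<Omega>" for x' y'
          using that 4 s t0 by (auto simp: Q)
        define H11 where "H11 = dx1 (dx1 u) P"
        define H12 where "H12 = dx1 (dx2 u) P"
        define H22 where "H22 = dx2 (dx2 u) P"
        have slice: "isCont (\<lambda>z. g (z, s)) (x, y)" if "continuous_on Q g" for g :: "point \<Rightarrow> real"
        proof -
          have "isCont g ((x, y), s)"
            using that openQ PQ by (simp add: continuous_on_eq_continuous_at Peq)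
          then show ?thesis
            by (rule isCont_o2[rotated]) (intro continuous_intros)
        qed
        \<comment> \<open>These are the spatial derivatives of \<open>w\<close> at time
          \<open>s\<close>. The perturbation is a sum of functions of one variable each, so
          \<open>?fxy\<close> is the mixed derivative of \<open>u\<close> itself and the argument of
          \<open>\<rho>\<close> is unchanged.\<close>
        let ?fx = "\<lambda>z. dx1 u (z, s) + \<epsilon> * (2 * fst z - (a + b))"
        let ?fy = "\<lambda>z. dx2 u (z, s) + \<epsilon> * (2 * snd z - (c + d))"
        let ?fxx = "\<lambda>z. dx1 (dx1 u) (z, s) + 2 * \<epsilon>"
        let ?fxy = "\<lambda>z. dx1 (dx2 u) (z, s)"
        let ?fyy = "\<lambda>z. dx2 (dx2 u) (z, s) + 2 * \<epsilon>"
        have minw: "\<And>z. z \<in> \<Omega> \<Longrightarrow> w ((x, y), s) \<le> w (z, s)"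
          using min_xy closure_subset by blast
        have D: "\<And>x y. (x, y) \<in> \<Omega> \<Longrightarrow> ((\<lambda>h. w ((h, y), s)) has_real_derivative ?fx (x, y)) (at x)"
          "\<And>x y. (x, y) \<in> \<Omega> \<Longrightarrow> ((\<lambda>h. w ((x, h), s)) has_real_derivative ?fy (x, y)) (at y)"
          "\<And>x y. (x, y) \<in> \<Omega> \<Longrightarrow> ((\<lambda>h. ?fx (h, y)) has_real_derivative ?fxx (x, y)) (at x)"
          "\<And>x y. (x, y) \<in> \<Omega> \<Longrightarrow> ((\<lambda>h. ?fy (h, y)) has_real_derivative ?fxy (x, y)) (at x)"
          "\<And>x y. (x, y) \<in> \<Omega> \<Longrightarrow> ((\<lambda>h. ?fy (x, h)) has_real_derivative ?fyy (x, y)) (at y)"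
          unfolding w_def sq_dist_centre_def
          by (auto intro!: derivative_eq_intros deriv inQ simp: field_simps simp del: dx1.simps dx2.simps)
        have contH: "isCont ?fxx (x, y)" "isCont ?fxy (x, y)" "isCont ?fyy (x, y)"
          by (intro continuous_intros slice cont)+
        note min2 = hessian_nonneg_at_minimum[OF openOm 4(2) D contH minw]
        have ux: "dx1 u P = - (\<epsilon> * (2 * x - (a + b)))" and uy: "dx2 u P = - (\<epsilon> * (2 * y - (c + d)))"
          using min2(1,2) by (auto simp: Peq simp del: dx1.simps dx2.simps)
        have quad: "0 \<le> p\<^sup>2 * (H11 + 2 * \<epsilon>) + 2 * p * q * H12 + q\<^sup>2 * (H22 + 2 * \<epsilon>)" for p q
          using min2(3)[of p q] by (simp add: H11_def H12_def H22_def Peq del: dx1.simps dx2.simps)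
        \<comment> \<open>Only earlier times are compared, since \<open>s\<close> may be the last
          time of \<open>K\<close>; this yields a sign rather than a zero. The perturbation is
          constant in time, so \<open>u\<close> inherits the comparison from
          \<open>w\<close>.\<close>
        have ut: "dt u P \<le> 0"
        proof (rule left_derivative_nonpos_at_minimum[of "\<lambda>h. u ((x, y), h)" _ s 0])
          have "((\<lambda>h. u ((x, y), h)) has_real_derivative dt u P) (at s)"
            using C1 PQ by (simp add: Peq DERIV_deriv_iff_real_differentiable)
          then show "((\<lambda>h. u ((x, y), h)) has_real_derivative dt u P) (at s within {0..s})"
            by (rule has_field_derivative_at_within)
          show "u ((x, y), s) \<le> u ((x, y), h)" if "0 \<le> h" "h \<le> s" for h
            using minP[of "((x, y), h)"] that s xy by (auto simp: K_def Peq w_def)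
        qed (use 4 in auto)
        text \<open>At \<open>H12 = 0\<close> nothing is known about \<open>\<rho> H12\<close>, not even \<open>\<bar>\<rho> H12\<bar> \<le> 1\<close>.\<close>
        define R where "R = (if H12 = 0 then 0 else \<rho> H12)"
        have R: "R * H12 = \<rho> H12 * H12" "\<bar>R\<bar> \<le> 1"
          using rho[of H12] assms(5-7) by (auto simp: R_def linorder_neq_iff)
        \<comment> \<open>The direction \<open>(\<sigma>1, R * \<sigma>2)\<close> produces the right
          mixed term but only the fraction \<open>R\<^sup>2\<close> of the last square. The missing
          part is nonnegative because \<open>\<bar>R\<bar> \<le> 1\<close> and the form is
          nonnegative in direction \<open>(0, 1)\<close>.\<close>
        have "0 \<le> (1 - R\<^sup>2) * (\<sigma>2\<^sup>2 * (H22 + 2 * \<epsilon>))"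
          using R(2) quad[of 0 1] by (intro mult_nonneg_nonneg) (auto simp: abs_square_le_1)
        with quad[of \<sigma>1 "R * \<sigma>2"]
        have elliptic: "0 \<le> \<sigma>1\<^sup>2 * (H11 + 2 * \<epsilon>) + 2 * \<sigma>1 * \<sigma>2 * (\<rho> H12 * H12) + \<sigma>2\<^sup>2 * (H22 + 2 * \<epsilon>)"
          unfolding R(1)[symmetric] by (simp add: algebra_simps power_mult_distrib)
        have "x \<in> {a<..<b}" "y \<in> {c<..<d}" using 4 by (auto simp: Om)
        then have "\<bar>k1 * (\<epsilon> * (2 * x - (a + b)))\<bar> \<le> \<epsilon> * (\<bar>k1\<bar> * (b - a))"
          "\<bar>k2 * (\<epsilon> * (2 * y - (c + d)))\<bar> \<le> \<epsilon> * (\<bar>k2\<bar> * (d - c))"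
          using \<epsilon> by (auto simp: abs_mult mult.left_commute[of _ \<epsilon>] intro!: mult_left_mono)
        then have "k1 * dx1 u P \<ge> - (\<epsilon> * (\<bar>k1\<bar> * (b - a)))" "k2 * dx2 u P \<ge> - (\<epsilon> * (\<bar>k2\<bar> * (d - c)))"
          unfolding ux uy by linarith+
        moreover have "r * u P = - dt u P + 1/2 * \<sigma>1\<^sup>2 * H11 + 1/2 * \<sigma>2\<^sup>2 * H22
            + \<rho> H12 * \<sigma>1 * \<sigma>2 * H12 + k1 * dx1 u P + k2 * dx2 u P"
          using pde[OF PQ] unfolding H11_def H12_def H22_def k1_def k2_def by linarith
        ultimately have "r * u P \<ge> - (\<epsilon> * C)"
          using ut elliptic unfolding C_def by (simp add: algebra_simps)
        then show ?thesis using \<open>r > 0\<close> by (simp add: field_simps)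
      qed
    qed
    \<comment> \<open>The bound at the minimum point passes to \<open>(z0, t0)\<close> through
      \<open>u P \<le> w P \<le> w (z0, t0)\<close>; the last term of the claim is the perturbation
      at \<open>z0\<close>.\<close>
    have "u P \<le> w P" using psi_nonneg \<epsilon> by (simp add: w_def)
    also have "\<dots> \<le> u (z0, t0) + \<epsilon> * ?\<psi> z0" using minP[OF z0K] by (simp add: w_def)
    finally show ?thesis using uP by (simp add: algebra_simps)
  qed

  have nonneg_Q: "u p \<ge> 0" if "p \<in> Q" for p
  proof -
    obtain z t where p: "p = (z, t)" "z \<in> \<Omega>" "0 < t" "t < T"
      using \<open>p \<in> Q\<close> unfolding Q by (metis SigmaE greaterThanLessThan_iff)
    have pos: "C / r + ?\<psi> z + 1 > 0"
      using C \<open>r > 0\<close> psi_nonneg[of z] by (simp add: add_nonneg_pos)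
    have "- u p \<le> 0 + e" if "e > 0" for e
    proof -
      \<comment> \<open>The added 1 makes the denominator positive, and with this choice the error
        in \<open>bound\<close> is \<open>e - \<epsilon>\<close>, hence below
        \<open>e\<close>.\<close>
      define \<epsilon> where "\<epsilon> = e / (C / r + ?\<psi> z + 1)"
      have "\<epsilon> > 0" using that pos by (simp add: \<epsilon>_def)
      moreover have "\<epsilon> * (C / r + ?\<psi> z + 1) = e" using pos by (simp add: \<epsilon>_def)
      ultimately show ?thesis
        using bound[OF p(2-4), of \<epsilon>] by (simp add: p(1) algebra_simps)
    qed
    then show ?thesis using field_le_epsilon[of "- u p" 0] by simp
  qed
  \<comment> \<open>Continuity extends the sign to the lateral sides and to the top
    \<open>t = T\<close>, where no equation is assumed.\<close>
  have "u p \<ge> 0" if "p \<in> closure Q" for p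
    by (rule continuous_ge_on_closure[OF regularity(1) that nonneg_Q])
  then show ?thesis by (auto simp: not_less)
qed

end
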